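(* Let $(L,\vee,\wedge)$ be a lattice and let $d:L\to L$ be a map. Then $d$ is both a differential operator and an integral operator on $L$ if and only if for all $x,y\in L$ $$d(x\vee y)=d(x)\vee d(y)\quad\text{and}\quad d(x\wedge y)=(d(x)\wedge y)\vee(x\wedge d(y)).$$
   Context: Let $(L,\vee,\wedge)$ be a lattice. An operator on $L$ is an arbitrary map $L\to L$. An operator $P$ on $L$ is an integral operator if for all $x,y\in L$: (1) $P(x\vee y)=P(x)\vee P(y)$, and (2) $P(x)\wedge P(y)=P(P(x)\wedge y)\vee P(x\wedge P(y))$. An operator $d$ on $L$ is a differential operator (or derivation) if $d(x\wedge y)=(d(x)\wedge y)\vee(x\wedge d(y))$ for all $x,y\in L$. *)

theory Defs
  imports Main
begin

unbundle lattice_syntax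

definition integral_operator :: "('a::lattice \<Rightarrow> 'a) \<Rightarrow> bool" where
  "integral_operator P \<longleftrightarrow>
     (\<forall>x y. P (x \<squnion> y) = P x \<squnion> P y) \<and>
     (\<forall>x y. P x \<sqinter> P y = P (P x \<sqinter> y) \<squnion> P (x \<sqinter> P y))"

definition differential_operator :: "('a::lattice \<Rightarrow> 'a) \<Rightarrow> bool" where
  "differential_operator d \<longleftrightarrow>
     (\<forall>x y. d (x \<sqinter> y) = (d x \<sqinter> y) \<squnion> (x \<sqinter> d y))"

end

theory Submission
  imports Defs
begin

text \<open>
  Only the second integral identity has to be derived, for a derivation \<open>d\<close> that preserves joins.
  Such a \<open>d\<close> collapses its right-hand side: joining the two terms under \<open>d\<close> produces exactly
  the Leibniz expression for \<open>d (x \<sqinter> y)\<close>, so the right-hand side is \<open>d (d (x \<sqinter> y))\<close>, which equals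
  \<open>d (x \<sqinter> y)\<close> because a derivation is idempotent. It then remains to see that \<open>d\<close> preserves meets,
  which holds because \<open>d\<close> is monotone and lies below the identity.
\<close>

text \<open>The Leibniz rule at \<open>x \<sqinter> x\<close> reads \<open>d x = d x \<sqinter> x\<close>.\<close>

lemma differential_operator_le:
  fixes d :: "'a::lattice \<Rightarrow> 'a"
  assumes "differential_operator d"
  shows "d x \<le> x"
proof -
  have "d (x \<sqinter> x) = (d x \<sqinter> x) \<squnion> (x \<sqinter> d x)"
    using assms unfolding differential_operator_def by blast
  then have "d x = d x \<sqinter> x"
    by (simp add: inf_commute)
  then show ?thesis
    by (metis inf_le2)
qed

text \<open>Since \<open>d x = x \<sqinter> d x\<close>, the Leibniz rule expands \<open>d (d x)\<close> into a join with \<open>d x\<close> as a term.\<close>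

lemma differential_operator_idem:
  fixes d :: "'a::lattice \<Rightarrow> 'a"
  assumes "differential_operator d"
  shows "d (d x) = d x"
proof (rule antisym)
  show "d (d x) \<le> d x"
    using assms by (rule differential_operator_le)
  have "x \<sqinter> d x = d x"
    using differential_operator_le[OF assms] by (rule inf_absorb2)
  moreover have "d (x \<sqinter> d x) = (d x \<sqinter> d x) \<squnion> (x \<sqinter> d (d x))"
    using assms unfolding differential_operator_def by blast
  ultimately show "d x \<le> d (d x)"
    by (metis inf_idem sup_ge1)
qed

text \<open>
  One inequality is monotonicity; for the other, \<open>d x \<sqinter> d y \<le> d x \<sqinter> y\<close>, which is one of the
  two terms of \<open>d (x \<sqinter> y)\<close>.
\<close>

lemma differential_operator_mono_inf:
  fixes d :: "'a::lattice \<Rightarrow> 'a"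
  assumes diff: "differential_operator d" and mono: "mono d"
  shows "d (x \<sqinter> y) = d x \<sqinter> d y"
proof (rule antisym)
  show "d (x \<sqinter> y) \<le> d x \<sqinter> d y"
    using mono by (rule mono_inf)
  have "d x \<sqinter> d y \<le> d x \<sqinter> y"
    using differential_operator_le[OF diff] by (intro inf_mono order_refl)
  also have "\<dots> \<le> (d x \<sqinter> y) \<squnion> (x \<sqinter> d y)"
    by (rule sup_ge1)
  also have "\<dots> = d (x \<sqinter> y)"
    using diff unfolding differential_operator_def by simp
  finally show "d x \<sqinter> d y \<le> d (x \<sqinter> y)" .
qed

lemma differential_operator_imp_integral_operator:
  fixes d :: "'a::lattice \<Rightarrow> 'a"
  assumes diff: "differential_operator d"
    and sup: "\<And>x y. d (x \<squnion> y) = d x \<squnion> d y"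
  shows "integral_operator d"
  unfolding integral_operator_def
proof (intro conjI allI)
  fix x y
  show "d (x \<squnion> y) = d x \<squnion> d y"
    by (rule sup)
  have "mono d"
    by (rule monoI) (metis sup le_iff_sup)
  then have "d x \<sqinter> d y = d (x \<sqinter> y)"
    using diff by (simp add: differential_operator_mono_inf)
  also have "\<dots> = d (d (x \<sqinter> y))"
    using diff by (simp add: differential_operator_idem)
  also have "d (x \<sqinter> y) = (d x \<sqinter> y) \<squnion> (x \<sqinter> d y)"
    using diff unfolding differential_operator_def by blast
  also have "d \<dots> = d (d x \<sqinter> y) \<squnion> d (x \<sqinter> d y)"
    by (rule sup)
  finally show "d x \<sqinter> d y = d (d x \<sqinter> y) \<squnion> d (x \<sqinter> d y)" .
qed

theorem proposition2p12:
  fixes d :: "'a::lattice \<Rightarrow> 'a"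
  shows "differential_operator d \<and> integral_operator d \<longleftrightarrow>
    (\<forall>x y. d (x \<squnion> y) = d x \<squnion> d y \<and>
           d (x \<sqinter> y) = (d x \<sqinter> y) \<squnion> (x \<sqinter> d y))"
proof
  assume "differential_operator d \<and> integral_operator d"
  then show "\<forall>x y. d (x \<squnion> y) = d x \<squnion> d y \<and>
      d (x \<sqinter> y) = (d x \<sqinter> y) \<squnion> (x \<sqinter> d y)"
    unfolding differential_operator_def integral_operator_def by blast
next
  assume *: "\<forall>x y. d (x \<squnion> y) = d x \<squnion> d y \<and>
      d (x \<sqinter> y) = (d x \<sqinter> y) \<squnion> (x \<sqinter> d y)"
  then have "differential_operator d"
    unfolding differential_operator_def by blast
  with * show "differential_operator d \<and> integral_operator d"
    using differential_operator_imp_integral_operator by blast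
qed

end
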